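(* Let $\mathbb{N}=\{1,2,3,\ldots\}$, let $(\lambda_n)_{n\in\mathbb{N}}$ be a fixed sequence of positive real numbers, and let $(\mathcal{Y}_n)_{n\in\mathbb{N}}$ be independent homogeneous Poisson point processes on $\mathbb{R}$, where $\mathcal{Y}_n$ has intensity $\lambda_n$. Let $BV$ be the event that there exists a function $f:\mathbb{R}\to\mathbb{R}$ of bounded variation with $f(n)\in\mathcal{Y}_n$ for all $n\in\mathbb{N}$. Then $P[BV]=0$ if any one of the following three conditions holds: (i) $(\lambda_n)_{n\in\mathbb{N}}$ is increasing and $\sum_{n\in\mathbb{N}}\frac{1}{\lambda_n}=\infty$; (ii) $\liminf_{n\to\infty}\lambda_n<\infty$; (iii) $\lim_{n\to\infty}\lambda_n=\infty$ and $\limsup_{n\to\infty}\frac{n}{\lambda_{(n)}}>0$, where $(\lambda_{(n)})_{n\in\mathbb{N}}$ is an increasingly ordered permutation of $(\lambda_n)_{n\in\mathbb{N}}$.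
   Context: All random objects are defined on a complete probability space $(\Omega,\mathcal{F},P)$. Each Poisson point process is regarded as a random closed (locally finite) subset of $\mathbb{R}$. "Increasing" means $\lambda_m\le\lambda_n$ for $m<n$ (not necessarily strictly). A function $f:\mathbb{R}\to\mathbb{R}$ is of bounded variation if its total variation over $\mathbb{R}$ is finite. That $BV\in\mathcal{F}$ follows from the completeness of the probability space and is part of the assertion. *)

theory Defs
  imports "HOL-Probability.Probability"
begin

definition locally_finite :: "real set \<Rightarrow> bool" where
  "locally_finite A \<longleftrightarrow> (\<forall>a b. finite (A \<inter> {a..b}))"

definition config_algebra :: "real set measure" where
  "config_algebra = sigma {A. locally_finite A}
     {{A. locally_finite A \<and> card (A \<inter> B) = k} | B k. B \<in> sets borel \<and> bounded B}"

text \<open>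
  The Poisson law is given by its mass function because \<^const>\<open>poisson_pmf\<close> requires a positive
  rate, whereas \<open>B\<close> may be a null set here; note that \<open>0 ^ 0 = 1\<close>.
\<close>

definition homogeneous_poisson_process ::
    "'w measure \<Rightarrow> ('w \<Rightarrow> real set) \<Rightarrow> real \<Rightarrow> bool" where
  "homogeneous_poisson_process M Y rate \<longleftrightarrow>
     Y \<in> measurable M config_algebra \<and>
     (\<forall>B k. B \<in> sets borel \<longrightarrow> bounded B \<longrightarrow>
        measure M {\<omega> \<in> space M. card (Y \<omega> \<inter> B) = k} =
          (rate * measure lborel B) ^ k / fact k * exp (- (rate * measure lborel B))) \<and>
     (\<forall>(n::nat) B. (\<forall>i<n. B i \<in> sets borel \<and> bounded (B i)) \<longrightarrow> disjoint_family_on B {..<n} \<longrightarrow>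
        prob_space.indep_vars M (\<lambda>_. count_space UNIV) (\<lambda>i \<omega>. card (Y \<omega> \<inter> B i)) {..<n})"

text \<open>
  Weakly monotone families of partition points give the same supremum as strictly monotone ones,
  since repeated points contribute 0.
\<close>

definition total_variation :: "(real \<Rightarrow> real) \<Rightarrow> ennreal" where
  "total_variation f =
     (SUP (n, t) \<in> {(n :: nat, t :: nat \<Rightarrow> real). mono_on {..n} t}.
        \<Sum>i<n. ennreal \<bar>f (t (Suc i)) - f (t i)\<bar>)"

definition BV :: "'w measure \<Rightarrow> (nat \<Rightarrow> 'w \<Rightarrow> real set) \<Rightarrow> 'w set" where
  "BV M Y = {\<omega> \<in> space M. \<exists>f :: real \<Rightarrow> real.
     total_variation f < \<infinity> \<and> (\<forall>n\<ge>1. f (real n) \<in> Y n \<omega>)}"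

text \<open>Sequences are indexed by the positive integers; the value at 0 is irrelevant.\<close>

definition increasing_rearrangement :: "(nat \<Rightarrow> real) \<Rightarrow> (nat \<Rightarrow> real) \<Rightarrow> bool" where
  "increasing_rearrangement r \<mu> \<longleftrightarrow>
     (\<exists>\<sigma>. bij_betw \<sigma> {1..} {1..} \<and> (\<forall>n\<ge>1. \<mu> n = r (\<sigma> n))) \<and> mono_on {1..} \<mu>"

end

theory Submission
  imports Defs
begin

text \<open>
  Only the values at the positive integers matter: the event says that some selection
  \<open>y n \<in> Y n \<omega>\<close> has summable increments. Since each \<open>Y n \<omega>\<close> is locally finite, a compactness
  argument reduces this to the existence, for some integer \<open>K\<close> and all \<open>N\<close>, of finite selections of
  length \<open>N\<close> with start and variation below \<open>K\<close>; these conditions are open, hence countable unions of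
  conditions on boxes, so the event is measurable.

  The probabilistic input is a union bound. Take \<open>r + 1\<close> of the processes with intensities at most
  \<open>L\<close> and cut the line into cells of width \<open>h = 1 / (144 L)\<close>. A selection of variation at most \<open>r h\<close>
  makes cell jumps of total size at most \<open>2 r\<close>. From a given start there are at most \<open>18 ^ r\<close>
  such cell paths, and each has all its cells occupied with probability at most \<open>144 ^ -(r + 1)\<close>, so
  selections starting in \<open>[-K, K]\<close> exist with probability at most \<open>(288 K L + 2) / 8 ^ r\<close>.

  In cases (ii) and (iii) there are \<open>C\<close> and arbitrarily large \<open>N\<close> such that \<open>N\<close> of the intensities are at
  most \<open>C N\<close>. With \<open>L = C N\<close> the threshold \<open>r h\<close> stays bounded below while the probability tends to
  0, so no tail of a selection has small variation. In case (i) the bound is applied to the dyadic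
  blocks from \<open>2 ^ k\<close> to \<open>2 ^ (k + 1)\<close>, ignoring those with \<open>\<lambda> (2 ^ (k + 1)) > 4 ^ k\<close>: by Borel-Cantelli the
  variation over almost all other blocks is at least a constant times \<open>2 ^ k / \<lambda> (2 ^ (k + 1))\<close>, and these
  terms have infinite sum by Cauchy condensation because the ignored ones are at most \<open>2 ^ -k\<close>.
\<close>

subsection \<open>Counting integer paths\<close>

text \<open>The two-sided geometric series of \<open>3 ^ -\<bar>d\<bar>\<close> has value 2, and its
  tail over \<open>\<bar>d\<bar> > R\<close> is \<open>3 ^ -R\<close>; after scaling by
  \<open>3 ^ R\<close> this tail is the added 1.\<close>

lemma sum_three_power:
  "(\<Sum>d\<in>{-int R..int R}. (3::nat) ^ (R - nat \<bar>d\<bar>)) + 1 = 2 * 3 ^ R"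
proof (induction R)
  case 0
  show ?case by simp
next
  case (Suc R)
  have split: "{-int (Suc R)..int (Suc R)} = insert (int (Suc R)) (insert (- int (Suc R)) {-int R..int R})"
    by auto
  have "(3::nat) ^ (Suc R - nat \<bar>d\<bar>) = 3 * 3 ^ (R - nat \<bar>d\<bar>)" if "d \<in> {-int R..int R}" for d
    using that by (simp flip: power_Suc add: Suc_diff_le nat_le_iff abs_le_iff)
  then have "(\<Sum>d\<in>{-int R..int R}. (3::nat) ^ (Suc R - nat \<bar>d\<bar>)) =
      3 * (\<Sum>d\<in>{-int R..int R}. 3 ^ (R - nat \<bar>d\<bar>))"
    by (simp add: sum_distrib_left)
  then have "(\<Sum>d\<in>{-int (Suc R)..int (Suc R)}. (3::nat) ^ (Suc R - nat \<bar>d\<bar>)) =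
      2 + 3 * (\<Sum>d\<in>{-int R..int R}. 3 ^ (R - nat \<bar>d\<bar>))"
    unfolding split by (subst sum.insert; simp)+
  with Suc.IH show ?case by simp
qed

text \<open>An integer path is encoded by its increments, so that its start can be counted
  separately.\<close>

definition steps :: "nat \<Rightarrow> nat \<Rightarrow> int list set" where
  "steps r R = {ds. length ds = r \<and> (\<Sum>d\<leftarrow>ds. \<bar>d\<bar>) \<le> int R}"

lemma steps_Suc:
  "steps (Suc r) R = (\<Union>d\<in>{-int R..int R}. (#) d ` steps r (R - nat \<bar>d\<bar>))"
proof (intro equalityI subsetI)
  fix xs assume "xs \<in> steps (Suc r) R"
  then obtain d ds where xs: "xs = d # ds" "length ds = r" "\<bar>d\<bar> + (\<Sum>d\<leftarrow>ds. \<bar>d\<bar>) \<le> int R"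
    by (auto simp: steps_def length_Suc_conv)
  moreover have "(\<Sum>d\<leftarrow>ds. \<bar>d\<bar>) \<ge> 0" by (rule sum_list_nonneg) auto
  ultimately have "d \<in> {-int R..int R}" "ds \<in> steps r (R - nat \<bar>d\<bar>)"
    by (auto simp: steps_def)
  with xs show "xs \<in> (\<Union>d\<in>{-int R..int R}. (#) d ` steps r (R - nat \<bar>d\<bar>))" by blast
qed (auto simp: steps_def)

lemma finite_steps: "finite (steps r R)"
proof (induction r arbitrary: R)
  case 0
  show ?case by (rule finite_subset[of _ "{[]}"]) (auto simp: steps_def)
qed (simp add: steps_Suc)

text \<open>The bound is the value at \<open>1 / 3\<close> of the generating function \<open>(\<Sum>d. x ^ \<bar>d\<bar>) ^ r / x ^ R\<close>.\<close>

lemma card_steps_le: "card (steps r R) \<le> 3 ^ R * 2 ^ r"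
proof (induction r arbitrary: R)
  case 0
  have "steps 0 R \<subseteq> {[]}" by (auto simp: steps_def)
  then have "card (steps 0 R) \<le> 1" using card_mono[of "{[]}" "steps 0 R"] by simp
  then show ?case by (simp add: order_trans[OF _ one_le_power])
next
  case (Suc r)
  have "card (steps (Suc r) R) \<le> (\<Sum>d\<in>{-int R..int R}. card ((#) d ` steps r (R - nat \<bar>d\<bar>)))"
    unfolding steps_Suc by (rule card_UN_le) simp
  also have "\<dots> \<le> (\<Sum>d\<in>{-int R..int R}. 3 ^ (R - nat \<bar>d\<bar>) * 2 ^ r)"
    by (intro sum_mono) (simp add: card_image Suc.IH)
  also have "\<dots> = (\<Sum>d\<in>{-int R..int R}. 3 ^ (R - nat \<bar>d\<bar>)) * 2 ^ r"
    by (simp add: sum_distrib_right)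
  also have "\<dots> \<le> (2 * 3 ^ R) * 2 ^ r"
    using sum_three_power[of R] by (intro mult_right_mono) auto
  finally show ?case by (simp add: mult_ac)
qed

subsection \<open>Sequences of bounded variation\<close>

text \<open>Triangle inequality on each gap between consecutive chosen indices, the gaps being
  disjoint. It serves both for partition points that round to integers and for variation along a
  sparse set of indices.\<close>

lemma sum_variation_le:
  fixes y :: "nat \<Rightarrow> 'a::real_normed_vector"
  assumes "mono_on {..n} k"
  shows "(\<Sum>i<n. norm (y (k (Suc i)) - y (k i))) \<le> (\<Sum>j\<in>{k 0..<k n}. norm (y (Suc j) - y j))"
  using assms
proof (induction n)
  case (Suc n)
  have le: "k 0 \<le> k n" "k n \<le> k (Suc n)"
    using Suc.prems by (auto intro: mono_onD)
  have "mono_on {..n} k" using Suc.prems by (rule mono_on_subset) auto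
  note IH = Suc.IH[OF this]
  have "norm (y (k (Suc n)) - y (k n)) = norm (\<Sum>j\<in>{k n..<k (Suc n)}. y (Suc j) - y j)"
    using le(2) by (simp add: sum_Suc_diff')
  also have "\<dots> \<le> (\<Sum>j\<in>{k n..<k (Suc n)}. norm (y (Suc j) - y j))"
    by (rule norm_sum)
  finally show ?case
    using IH sum.atLeastLessThan_concat[OF le, of "\<lambda>j. norm (y (Suc j) - y j)"] by simp
qed simp

lemma summable_variation_if_bounded_variation:
  assumes "total_variation f < \<infinity>"
  shows "summable (\<lambda>n. \<bar>f (real (Suc n)) - f (real n)\<bar>)"
proof (rule summableI_nonneg_bounded)
  fix n
  \<comment> \<open>The integers from 0 to \<open>n\<close> serve as partition points.\<close>
  have "(n, real) \<in> {(n :: nat, t :: nat \<Rightarrow> real). mono_on {..n} t}"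
    by (auto intro!: mono_onI)
  then have "(\<Sum>i<n. ennreal \<bar>f (real (Suc i)) - f (real i)\<bar>) \<le> total_variation f"
    unfolding total_variation_def by (rule SUP_upper2) simp
  also have "\<dots> = ennreal (enn2real (total_variation f))"
    using assms by simp
  finally show "(\<Sum>i<n. \<bar>f (real (Suc i)) - f (real i)\<bar>) \<le> enn2real (total_variation f)"
    by (simp add: sum_nonneg)
qed simp

text \<open>Rounding down turns any partition into a weakly monotone family of indices, to which
  \<open>sum_variation_le\<close> applies. Since \<open>nat\<close> sends negative integers to 0,
  the function is constant to the left of 1.\<close>

lemma total_variation_step_function:
  fixes y :: "nat \<Rightarrow> real"
  assumes "summable (\<lambda>n. \<bar>y (Suc n) - y n\<bar>)"
  shows "total_variation (\<lambda>x. y (nat \<lfloor>x\<rfloor>)) < \<infinity>"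
proof -
  have "(\<Sum>i<n. ennreal \<bar>y (nat \<lfloor>t (Suc i)\<rfloor>) - y (nat \<lfloor>t i\<rfloor>)\<bar>) \<le> ennreal (\<Sum>n. \<bar>y (Suc n) - y n\<bar>)"
    if "mono_on {..n} t" for n and t :: "nat \<Rightarrow> real"
  proof -
    have "mono_on {..n} (\<lambda>i. nat \<lfloor>t i\<rfloor>)"
      using that by (intro mono_onI nat_mono floor_mono) (auto elim: mono_onD)
    from sum_variation_le[OF this, of y]
    have "(\<Sum>i<n. \<bar>y (nat \<lfloor>t (Suc i)\<rfloor>) - y (nat \<lfloor>t i\<rfloor>)\<bar>) \<le>
        (\<Sum>j\<in>{nat \<lfloor>t 0\<rfloor>..<nat \<lfloor>t n\<rfloor>}. \<bar>y (Suc j) - y j\<bar>)"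
      by simp
    also have "\<dots> \<le> (\<Sum>n. \<bar>y (Suc n) - y n\<bar>)"
      by (rule sum_le_suminf[OF assms]) auto
    finally show ?thesis by (simp add: sum_ennreal ennreal_leI)
  qed
  then have "total_variation (\<lambda>x. y (nat \<lfloor>x\<rfloor>)) \<le> ennreal (\<Sum>n. \<bar>y (Suc n) - y n\<bar>)"
    unfolding total_variation_def by (intro SUP_least) auto
  also have "\<dots> < \<infinity>" by simp
  finally show ?thesis .
qed

text \<open>Restriction to the integers gives one direction, the step function the other. The free
  value \<open>y 0\<close> enters a single increment, which does not affect summability.\<close>

lemma BV_iff_summable_variation:
  "BV M Y = {\<omega> \<in> space M. \<exists>y. summable (\<lambda>n. \<bar>y (Suc n) - y n\<bar>) \<and> (\<forall>n\<ge>1. y n \<in> Y n \<omega>)}"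
proof -
  have "(\<exists>f. total_variation f < \<infinity> \<and> (\<forall>n\<ge>1. f (real n) \<in> A n)) \<longleftrightarrow>
      (\<exists>y. summable (\<lambda>n. \<bar>y (Suc n) - y n\<bar>) \<and> (\<forall>n\<ge>1. y n \<in> A n))" (is "?L \<longleftrightarrow> ?R")
    for A :: "nat \<Rightarrow> real set"
  proof
    assume ?L
    then obtain f where f: "total_variation f < \<infinity>" "\<forall>n\<ge>1. f (real n) \<in> A n" by blast
    then show ?R
      using summable_variation_if_bounded_variation[OF f(1)]
      by (intro exI[of _ "\<lambda>n. f (real n)"]) auto
  next
    assume ?R
    then obtain y where y: "summable (\<lambda>n. \<bar>y (Suc n) - y n\<bar>)" "\<forall>n\<ge>1. y n \<in> A n" by blast
    then show ?L
      using total_variation_step_function[OF y(1)]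
      by (intro exI[of _ "\<lambda>x. y (nat \<lfloor>x\<rfloor>)"]) auto
  qed
  then show ?thesis unfolding BV_def by simp
qed

lemma summable_variation_bounded:
  fixes y :: "nat \<Rightarrow> real"
  assumes "summable (\<lambda>n. \<bar>y (Suc n) - y n\<bar>)"
  shows "\<bar>y n\<bar> \<le> \<bar>y 0\<bar> + (\<Sum>n. \<bar>y (Suc n) - y n\<bar>)"
proof -
  have "\<bar>y n - y 0\<bar> \<le> (\<Sum>i<n. \<bar>y (Suc i) - y i\<bar>)"
    by (metis sum_abs sum_lessThan_telescope)
  also have "\<dots> \<le> (\<Sum>n. \<bar>y (Suc n) - y n\<bar>)"
    by (rule sum_le_suminf[OF assms]) auto
  finally show ?thesis by simp
qed

text \<open>Tychonoff: admissible values at each index form a finite set, so their product is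
  compact, and the bounds on partial variations are closed conditions that become stronger with
  \<open>N\<close>. The finite selections give the finite intersection property.\<close>

lemma exists_summable_variation_if_finite:
  fixes A :: "nat \<Rightarrow> real set"
  assumes lf: "\<And>n. n \<ge> 1 \<Longrightarrow> locally_finite (A n)"
    and ex: "\<And>N. \<exists>y. (\<forall>i\<in>{1..N}. y i \<in> A i) \<and> \<bar>y 1\<bar> \<le> K \<and> (\<Sum>i\<in>{1..<N}. \<bar>y (Suc i) - y i\<bar>) \<le> K"
  shows "\<exists>y. summable (\<lambda>n. \<bar>y (Suc n) - y n\<bar>) \<and> (\<forall>n\<ge>1. y n \<in> A n)"
proof -
  \<comment> \<open>A start of size at most \<open>K\<close> followed by variation at most
    \<open>K\<close> stays within \<open>2 * K\<close>. Index 0, on which there is no constraint, is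
    pinned to 0.\<close>
  define S where "S n = (if n = 0 then {0} else A n \<inter> {-2*K..2*K})" for n
  define F where "F N = {y::nat \<Rightarrow> real. (\<Sum>i\<in>{1..<N}. \<bar>y (Suc i) - y i\<bar>) \<le> K}" for N
  have "compact (S n)" for n
    using lf by (auto simp: S_def locally_finite_def intro!: finite_imp_compact)
  then have "compactin (product_topology (\<lambda>_. euclidean) UNIV) (Pi\<^sub>E UNIV S)"
    by (simp add: compactin_PiE)
  then have compact: "compact (Pi\<^sub>E UNIV S)"
    by (simp add: euclidean_product_topology)
  have closed: "closed (F N)" for N
    unfolding F_def by (intro closed_Collect_le continuous_intros) simp_all
  have path: "\<exists>y. (\<forall>i\<in>{1..N}. y i \<in> S i) \<and> y \<in> F N" for N
  proof -
    obtain y where y: "\<forall>i\<in>{1..N}. y i \<in> A i" "\<bar>y 1\<bar> \<le> K" "y \<in> F N"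
      using ex[of N] unfolding F_def by blast
    have "\<bar>y i\<bar> \<le> 2 * K" if i: "i \<in> {1..N}" for i
    proof -
      have "\<bar>y i - y 1\<bar> = \<bar>\<Sum>j\<in>{1..<i}. y (Suc j) - y j\<bar>"
        using i by (subst sum_Suc_diff') auto
      also have "\<dots> \<le> (\<Sum>j\<in>{1..<i}. \<bar>y (Suc j) - y j\<bar>)" by (rule sum_abs)
      also have "\<dots> \<le> (\<Sum>j\<in>{1..<N}. \<bar>y (Suc j) - y j\<bar>)"
        using i by (intro sum_mono2) auto
      also have "\<dots> \<le> K" using y by (simp add: F_def)
      finally show ?thesis using y(2) by linarith
    qed
    then have "\<forall>i\<in>{1..N}. y i \<in> S i"
      using y(1) by (force simp: S_def abs_le_iff)
    with y(3) show ?thesis by blast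
  qed
  have nonempty: "S n \<noteq> {}" for n
  proof (cases "n = 0")
    case False
    then have "n \<in> {1..n}" by simp
    then show ?thesis using path[of n] by blast
  qed (simp add: S_def)
  have "Pi\<^sub>E UNIV S \<inter> (\<Inter>N\<in>UNIV. F N) \<noteq> {}"
  proof (rule compact_imp_fip_image[OF compact closed])
    fix I :: "nat set" assume I: "finite I"
    define N where "N = Max (insert 0 I)"
    obtain y where y: "\<forall>i\<in>{1..N}. y i \<in> S i" "y \<in> F N" using path by blast
    \<comment> \<open>Coordinates outside \<open>{1..N}\<close> do not enter \<open>F N\<close> and
      may be filled arbitrarily from \<open>S\<close>.\<close>
    define z where "z i = (if i \<in> {1..N} then y i else SOME x. x \<in> S i)" for i
    have "z i \<in> S i" for i
      using y(1) nonempty[of i] by (auto simp: z_def some_in_eq)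
    moreover have "z \<in> F N"
    proof -
      have "(\<Sum>i\<in>{1..<N}. \<bar>z (Suc i) - z i\<bar>) = (\<Sum>i\<in>{1..<N}. \<bar>y (Suc i) - y i\<bar>)"
        by (intro sum.cong) (auto simp: z_def)
      with y(2) show ?thesis by (simp add: F_def)
    qed
    moreover have "F N \<subseteq> F n" if "n \<in> I" for n
    proof -
      have "n \<le> N" using that I by (simp add: N_def)
      then have "(\<Sum>i\<in>{1..<n}. \<bar>y (Suc i) - y i\<bar>) \<le> (\<Sum>i\<in>{1..<N}. \<bar>y (Suc i) - y i\<bar>)" for y :: "nat \<Rightarrow> real"
        by (intro sum_mono2) auto
      then show ?thesis unfolding F_def by (blast intro: order_trans)
    qed
    ultimately show "Pi\<^sub>E UNIV S \<inter> (\<Inter>n\<in>I. F n) \<noteq> {}" by blast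
  qed
  then obtain y where y: "\<And>n. y n \<in> S n" "\<And>N. y \<in> F N" by blast
  have "summable (\<lambda>n. \<bar>y (Suc n) - y n\<bar>)"
  proof (rule summableI_nonneg_bounded)
    fix n
    \<comment> \<open>The increment from index 0 to 1 is not controlled by \<open>F n\<close> and is
      split off.\<close>
    have "(\<Sum>i<n. \<bar>y (Suc i) - y i\<bar>) \<le> (\<Sum>i\<in>insert 0 {1..<n}. \<bar>y (Suc i) - y i\<bar>)"
      by (intro sum_mono2) auto
    also have "\<dots> \<le> \<bar>y 1 - y 0\<bar> + K" using y(2)[of n] by (simp add: F_def)
    finally show "(\<Sum>i<n. \<bar>y (Suc i) - y i\<bar>) \<le> \<bar>y 1 - y 0\<bar> + K" .
  qed simp
  moreover have "y n \<in> A n" if "n \<ge> 1" for n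
    using y(1)[of n] that by (simp add: S_def)
  ultimately show ?thesis by blast
qed

text \<open>The form is chosen for measurability: the strict inequalities are open conditions on
  finitely many coordinates, and \<open>K\<close> and \<open>N\<close> range over countable
  sets.\<close>

lemma exists_summable_variation_iff:
  fixes A :: "nat \<Rightarrow> real set"
  assumes "\<And>n. n \<ge> 1 \<Longrightarrow> locally_finite (A n)"
  shows "(\<exists>y. summable (\<lambda>n. \<bar>y (Suc n) - y n\<bar>) \<and> (\<forall>n\<ge>1. y n \<in> A n)) \<longleftrightarrow>
    (\<exists>K::nat. \<forall>N. \<exists>y. (\<forall>i\<in>{1..N}. y i \<in> A i) \<and> \<bar>y 1\<bar> < K \<and> (\<Sum>i\<in>{1..<N}. \<bar>y (Suc i) - y i\<bar>) < K)"
    (is "?L \<longleftrightarrow> ?R")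
proof
  assume ?L
  then obtain y where y: "summable (\<lambda>n. \<bar>y (Suc n) - y n\<bar>)" "\<forall>n\<ge>1. y n \<in> A n" by blast
  obtain K :: nat where K: "\<bar>y 0\<bar> + (\<Sum>n. \<bar>y (Suc n) - y n\<bar>) < K"
    using reals_Archimedean2 by blast
  have "\<bar>y 1\<bar> < K"
    using summable_variation_bounded[OF y(1), of 1] K by linarith
  moreover have "(\<Sum>i\<in>{1..<N}. \<bar>y (Suc i) - y i\<bar>) < K" for N
  proof -
    have "(\<Sum>i\<in>{1..<N}. \<bar>y (Suc i) - y i\<bar>) \<le> (\<Sum>n. \<bar>y (Suc n) - y n\<bar>)"
      by (rule sum_le_suminf[OF y(1)]) auto
    with K show ?thesis by linarith
  qed
  ultimately show ?R using y(2) by (intro exI[of _ K] allI exI[of _ y]) auto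
next
  assume ?R
  then obtain K :: nat where K: "\<And>N. \<exists>y. (\<forall>i\<in>{1..N}. y i \<in> A i) \<and> \<bar>y 1\<bar> < real K \<and>
      (\<Sum>i\<in>{1..<N}. \<bar>y (Suc i) - y i\<bar>) < real K" by blast
  show ?L
  proof (rule exists_summable_variation_if_finite[OF assms, where K = "real K"])
    fix N show "\<exists>y. (\<forall>i\<in>{1..N}. y i \<in> A i) \<and> \<bar>y 1\<bar> \<le> real K \<and> (\<Sum>i\<in>{1..<N}. \<bar>y (Suc i) - y i\<bar>) \<le> real K"
      using K[of N] by (meson less_imp_le)
  qed
qed

subsection \<open>Measurability\<close>

lemma space_config_algebra: "space config_algebra = {A. locally_finite A}"
  unfolding config_algebra_def by (rule space_measure_of) auto

lemma sets_config_algebra_card: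
  assumes "B \<in> sets borel" "bounded B"
  shows "{A. locally_finite A \<and> card (A \<inter> B) = k} \<in> sets config_algebra"
proof -
  have "{{A. locally_finite A \<and> card (A \<inter> B) = k} | B k. B \<in> sets borel \<and> bounded B} \<subseteq> Pow {A. locally_finite A}"
    by auto
  from sets_measure_of[OF this] show ?thesis
    unfolding config_algebra_def using assms by blast
qed

lemma finite_Int_if_locally_finite:
  assumes "locally_finite A" "bounded B"
  shows "finite (A \<inter> B)"
proof -
  obtain c where "\<forall>x\<in>B. \<bar>x\<bar> \<le> c" using assms(2) by (auto simp: bounded_iff)
  then have "A \<inter> B \<subseteq> A \<inter> {-c..c}" by (auto simp: abs_le_iff minus_le_iff)
  moreover have "finite (A \<inter> {-c..c})" using assms(1) by (simp add: locally_finite_def)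
  ultimately show ?thesis by (rule finite_subset)
qed

text \<open>For bounded sets, hitting is the complement of count 0; local finiteness rules out that
  \<open>card\<close> is 0 because the intersection is infinite. A general set is exhausted by its
  bounded parts.\<close>

lemma sets_config_algebra_hit:
  assumes B: "B \<in> sets borel"
  shows "{A. locally_finite A \<and> A \<inter> B \<noteq> {}} \<in> sets config_algebra"
proof -
  have bounded: "{A. locally_finite A \<and> A \<inter> C \<noteq> {}} \<in> sets config_algebra"
    if C: "C \<in> sets borel" "bounded C" for C
  proof -
    have "{A. locally_finite A \<and> A \<inter> C \<noteq> {}} = space config_algebra - {A. locally_finite A \<and> card (A \<inter> C) = 0}"
      using C by (auto simp: space_config_algebra finite_Int_if_locally_finite)
    then show ?thesis using sets_config_algebra_card[OF C, of 0] by auto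
  qed
  have "{A. locally_finite A \<and> A \<inter> B \<noteq> {}} =
      (\<Union>m::nat. {A. locally_finite A \<and> A \<inter> (B \<inter> {-real m..real m}) \<noteq> {}})"
  proof (intro equalityI subsetI)
    fix A assume "A \<in> {A. locally_finite A \<and> A \<inter> B \<noteq> {}}"
    then obtain x where "locally_finite A" "x \<in> A" "x \<in> B" by blast
    moreover obtain m where "\<bar>x\<bar> < real m" using reals_Archimedean2 by blast
    ultimately have "locally_finite A \<and> x \<in> A \<inter> (B \<inter> {-real m..real m})" by auto
    then show "A \<in> (\<Union>m::nat. {A. locally_finite A \<and> A \<inter> (B \<inter> {-real m..real m}) \<noteq> {}})"
      by blast
  qed auto
  also have "\<dots> \<in> sets config_algebra"
    using B by (intro sets.countable_UN'' bounded bounded_Int) auto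
  finally show ?thesis .
qed

locale poisson_processes = prob_space M for M :: "'w measure" +
  fixes rate :: "nat \<Rightarrow> real" and Y :: "nat \<Rightarrow> 'w \<Rightarrow> real set"
  assumes rate_pos: "n \<ge> 1 \<Longrightarrow> rate n > 0"
    and poisson: "n \<ge> 1 \<Longrightarrow> homogeneous_poisson_process M (Y n) (rate n)"
    and indep: "indep_vars (\<lambda>_. config_algebra) Y {1..}"
begin

lemma measurable_Y: "n \<ge> 1 \<Longrightarrow> Y n \<in> measurable M config_algebra"
  using poisson by (simp add: homogeneous_poisson_process_def)

lemma locally_finite_Y: "n \<ge> 1 \<Longrightarrow> \<omega> \<in> space M \<Longrightarrow> locally_finite (Y n \<omega>)"
  using measurable_space[OF measurable_Y] by (simp add: space_config_algebra)

lemma hit_eq_vimage: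
  "n \<ge> 1 \<Longrightarrow> {\<omega> \<in> space M. Y n \<omega> \<inter> B \<noteq> {}} = Y n -` {A. locally_finite A \<and> A \<inter> B \<noteq> {}} \<inter> space M"
  using locally_finite_Y by auto

lemma hit_event: "n \<ge> 1 \<Longrightarrow> B \<in> sets borel \<Longrightarrow> {\<omega> \<in> space M. Y n \<omega> \<inter> B \<noteq> {}} \<in> events"
  by (simp only: hit_eq_vimage) (rule measurable_sets[OF measurable_Y sets_config_algebra_hit])

text \<open>An open set is a countable union of basic boxes, and on a nonempty box the choices at
  different indices decouple into separate hitting conditions.\<close>

lemma open_selection_event:
  assumes "open (U :: (nat \<Rightarrow> real) set)" "I \<subseteq> {1..}"
  shows "{\<omega> \<in> space M. \<exists>y\<in>U. \<forall>i\<in>I. y i \<in> Y i \<omega>} \<in> events"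
proof -
  obtain \<B> :: "(nat \<Rightarrow> real) set set" where \<B>: "topological_basis \<B>" "countable \<B>"
    "\<And>k. k \<in> \<B> \<Longrightarrow> \<exists>X. k = Pi\<^sub>E UNIV X \<and> (\<forall>i. open (X i)) \<and> finite {i. X i \<noteq> UNIV}"
    using product_topology_countable_basis[where 'a = nat and 'b = real] by blast
  obtain \<C> where \<C>: "\<C> \<subseteq> \<B>" "\<Union>\<C> = U"
    using \<B>(1) assms(1) by (auto simp: topological_basis_def)
  have event: "{\<omega> \<in> space M. \<exists>y\<in>k. \<forall>i\<in>I. y i \<in> Y i \<omega>} \<in> events" if "k \<in> \<C>" for k
  proof (cases "k = {}")
    case False
    obtain X where X: "k = Pi\<^sub>E UNIV X" "\<And>i. open (X i)"
      using \<B>(3) \<C>(1) \<open>k \<in> \<C>\<close> by blast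
    have "(\<exists>y\<in>k. \<forall>i\<in>I. y i \<in> Y i \<omega>) \<longleftrightarrow> (\<forall>i\<in>I. Y i \<omega> \<inter> X i \<noteq> {})" for \<omega>
    proof
      assume "\<exists>y\<in>k. \<forall>i\<in>I. y i \<in> Y i \<omega>"
      then show "\<forall>i\<in>I. Y i \<omega> \<inter> X i \<noteq> {}" unfolding X(1) by blast
    next
      assume "\<forall>i\<in>I. Y i \<omega> \<inter> X i \<noteq> {}"
      then have "\<forall>i\<in>I. \<exists>x. x \<in> Y i \<omega> \<inter> X i" by blast
      from bchoice[OF this] obtain z where z: "\<forall>i\<in>I. z i \<in> Y i \<omega> \<inter> X i" by blast
      \<comment> \<open>A point of the box supplies the coordinates outside \<open>I\<close>; this
        is why the empty box is treated apart.\<close>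
      obtain x where x: "x \<in> k" using False by blast
      have "(\<lambda>i. if i \<in> I then z i else x i) \<in> k"
        using z x by (auto simp: X(1))
      then show "\<exists>y\<in>k. \<forall>i\<in>I. y i \<in> Y i \<omega>"
        using z by (intro bexI[of _ "\<lambda>i. if i \<in> I then z i else x i"]) auto
    qed
    then have "{\<omega> \<in> space M. \<exists>y\<in>k. \<forall>i\<in>I. y i \<in> Y i \<omega>} = {\<omega> \<in> space M. \<forall>i. i \<in> I \<longrightarrow> Y i \<omega> \<inter> X i \<noteq> {}}"
      by auto
    also have "\<dots> \<in> events"
    proof (rule sets.sets_Collect_countable_All)
      fix i
      show "{\<omega> \<in> space M. i \<in> I \<longrightarrow> Y i \<omega> \<inter> X i \<noteq> {}} \<in> events"
        using hit_event[of i "X i"] X(2)[of i] assms(2) by (cases "i \<in> I") auto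
    qed
    finally show ?thesis .
  qed simp
  have "{\<omega> \<in> space M. \<exists>y\<in>U. \<forall>i\<in>I. y i \<in> Y i \<omega>} = (\<Union>k\<in>\<C>. {\<omega> \<in> space M. \<exists>y\<in>k. \<forall>i\<in>I. y i \<in> Y i \<omega>})"
    using \<C>(2) by blast
  also have "\<dots> \<in> events"
    using countable_subset[OF \<C>(1) \<B>(2)] event by (intro sets.countable_UN') auto
  finally show ?thesis .
qed

lemma BV_event: "BV M Y \<in> events"
proof -
  define U where "U K N = {y::nat \<Rightarrow> real. \<bar>y 1\<bar> < K \<and> (\<Sum>i\<in>{1..<N}. \<bar>y (Suc i) - y i\<bar>) < K}" for K and N :: nat
  have "open (U K N)" for K N
    unfolding U_def by (intro open_Collect_conj open_Collect_less continuous_intros) simp_all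
  then have event: "{\<omega> \<in> space M. \<exists>y\<in>U K N. \<forall>i\<in>{1..N}. y i \<in> Y i \<omega>} \<in> events" for K N
    by (rule open_selection_event) auto
  have "BV M Y = {\<omega> \<in> space M. \<exists>K::nat. \<forall>N. \<exists>y\<in>U K N. \<forall>i\<in>{1..N}. y i \<in> Y i \<omega>}"
    unfolding BV_iff_summable_variation U_def
    by (intro Collect_cong conj_cong refl, subst exists_summable_variation_iff)
      (auto simp: locally_finite_Y Bex_def conj_ac)
  also have "\<dots> \<in> events"
    by (rule sets.sets_Collect_countable_Ex, rule sets.sets_Collect_countable_All, rule event)
  finally show ?thesis .
qed

subsection \<open>Union bound over cell paths\<close>

text \<open>The void probability is \<open>exp (-x)\<close> with \<open>x\<close> the expected
  number of points, and \<open>1 - exp (-x) \<le> x\<close>.\<close>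

lemma prob_hit_le:
  assumes n: "n \<ge> 1" and B: "B \<in> sets borel" "bounded B"
  shows "prob {\<omega> \<in> space M. Y n \<omega> \<inter> B \<noteq> {}} \<le> rate n * measure lborel B"
proof -
  have "{\<omega> \<in> space M. Y n \<omega> \<inter> B \<noteq> {}} = space M - {\<omega> \<in> space M. card (Y n \<omega> \<inter> B) = 0}"
    using n B by (auto simp: finite_Int_if_locally_finite locally_finite_Y)
  moreover have "{\<omega> \<in> space M. card (Y n \<omega> \<inter> B) = 0} \<in> events"
  proof -
    have "{\<omega> \<in> space M. card (Y n \<omega> \<inter> B) = 0} =
        Y n -` {A. locally_finite A \<and> card (A \<inter> B) = 0} \<inter> space M"
      using locally_finite_Y[OF n] by auto
    then show ?thesis
      using measurable_sets[OF measurable_Y[OF n] sets_config_algebra_card[OF B, of 0]] by simp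
  qed
  moreover have "prob {\<omega> \<in> space M. card (Y n \<omega> \<inter> B) = 0} = exp (- (rate n * measure lborel B))"
  proof -
    have "prob {\<omega> \<in> space M. card (Y n \<omega> \<inter> B) = 0} =
        (rate n * measure lborel B) ^ 0 / fact 0 * exp (- (rate n * measure lborel B))"
      using poisson[OF n] B unfolding homogeneous_poisson_process_def by blast
    then show ?thesis by simp
  qed
  ultimately have "prob {\<omega> \<in> space M. Y n \<omega> \<inter> B \<noteq> {}} = 1 - exp (- (rate n * measure lborel B))"
    by (simp add: prob_compl)
  then show ?thesis
    using exp_ge_add_one_self[of "- (rate n * measure lborel B)"] by linarith
qed

lemma prob_Inter_hit:
  assumes "J \<noteq> {}" "finite J" "J \<subseteq> {1..}" "\<And>i. i \<in> J \<Longrightarrow> B i \<in> sets borel"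
  shows "prob (\<Inter>i\<in>J. {\<omega> \<in> space M. Y i \<omega> \<inter> B i \<noteq> {}}) = (\<Prod>i\<in>J. prob {\<omega> \<in> space M. Y i \<omega> \<inter> B i \<noteq> {}})"
proof -
  have eq: "{\<omega> \<in> space M. Y i \<omega> \<inter> B i \<noteq> {}} = Y i -` {A. locally_finite A \<and> A \<inter> B i \<noteq> {}} \<inter> space M"
    if "i \<in> J" for i
    using that assms(3) by (intro hit_eq_vimage) auto
  have "prob (\<Inter>i\<in>J. Y i -` {A. locally_finite A \<and> A \<inter> B i \<noteq> {}} \<inter> space M) =
      (\<Prod>i\<in>J. prob (Y i -` {A. locally_finite A \<and> A \<inter> B i \<noteq> {}} \<inter> space M))"
    using assms by (intro indep_varsD[OF indep] sets_config_algebra_hit) auto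
  then show ?thesis by (simp add: eq cong: INF_cong_simp prod.cong_simp)
qed

text \<open>The conclusion provides a covering event, so that measurability of the set of outcomes
  with a short selection need not be discussed.\<close>

lemma short_path_event:
  assumes inj: "inj_on n {..r}" and n: "\<And>i. i \<le> r \<Longrightarrow> n i \<ge> 1" "\<And>i. i \<le> r \<Longrightarrow> rate (n i) \<le> L"
    and L: "L > 0" and K: "K \<ge> 0"
  obtains E where "E \<in> events" "prob E \<le> (288 * K * L + 2) / 8 ^ r"
    "\<And>\<omega> y. \<omega> \<in> space M \<Longrightarrow> (\<And>i. i \<le> r \<Longrightarrow> y i \<in> Y (n i) \<omega>) \<Longrightarrow> \<bar>y 0\<bar> \<le> K \<Longrightarrow>
       (\<Sum>i<r. \<bar>y (Suc i) - y i\<bar>) \<le> real r / (144 * L) \<Longrightarrow> \<omega> \<in> E"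
proof -
  \<comment> \<open>The constant is \<open>144 = 18 * 8\<close>: with jump budget
    \<open>2 * r\<close> there are at most \<open>3 ^ (2 * r) * 2 ^ r = 18 ^ r\<close> increment
    lists, which leaves a factor \<open>8 ^ -r\<close>.\<close>
  define h where "h = 1 / (144 * L)"
  define cell where "cell j = {h * real_of_int j..<h * real_of_int j + h}" for j :: int
  define A where "A g = (\<Inter>i\<in>{..r}. {\<omega> \<in> space M. Y (n i) \<omega> \<inter> cell (g i) \<noteq> {}})" for g :: "nat \<Rightarrow> int"
  define starts where "starts = {\<lfloor>-(K / h)\<rfloor>..\<lfloor>K / h\<rfloor>}"
  define path where "path a ds i = a + (\<Sum>j<i. ds ! j)" for a :: int and ds and i :: nat
  define E where "E = (\<Union>(a, ds)\<in>starts \<times> steps r (2 * r). A (path a ds))"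
  have h: "h > 0" using L by (simp add: h_def)
  have cell: "cell j \<in> sets borel" "bounded (cell j)" "measure lborel (cell j) = h" for j
    using h by (simp_all add: cell_def)
  have A_event: "A g \<in> events" for g
    unfolding A_def using n(1) cell(1) by (intro sets.finite_INT hit_event) auto
  have A_prob: "prob (A g) \<le> (1 / 144) ^ Suc r" for g
  proof -
    \<comment> \<open>Independence is indexed by the processes, not by positions on the path;
      injectivity of \<open>n\<close> allows the translation.\<close>
    define m where "m = the_inv_into {..r} n"
    have m: "m (n i) = i" if "i \<le> r" for i
      using inj that by (simp add: m_def the_inv_into_f_f)
    have "A g = (\<Inter>i\<in>n ` {..r}. {\<omega> \<in> space M. Y i \<omega> \<inter> cell (g (m i)) \<noteq> {}})"
      unfolding A_def by (auto simp: m)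
    also have "prob \<dots> = (\<Prod>i\<in>n ` {..r}. prob {\<omega> \<in> space M. Y i \<omega> \<inter> cell (g (m i)) \<noteq> {}})"
      using n(1) cell(1) by (intro prob_Inter_hit) auto
    also have "\<dots> = (\<Prod>i\<le>r. prob {\<omega> \<in> space M. Y (n i) \<omega> \<inter> cell (g i) \<noteq> {}})"
      by (simp add: prod.reindex[OF inj] m)
    also have "\<dots> \<le> (\<Prod>i\<le>r. 1 / 144)"
    proof (intro prod_mono conjI measure_nonneg)
      fix i assume "i \<in> {..r}"
      then have "prob {\<omega> \<in> space M. Y (n i) \<omega> \<inter> cell (g i) \<noteq> {}} \<le> rate (n i) * h"
        using prob_hit_le[of "n i" "cell (g i)"] n(1) cell by simp
      also have "\<dots> \<le> L * h" using n(2) h \<open>i \<in> {..r}\<close> by (intro mult_right_mono) auto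
      also have "\<dots> = 1 / 144" using L by (simp add: h_def)
      finally show "prob {\<omega> \<in> space M. Y (n i) \<omega> \<inter> cell (g i) \<noteq> {}} \<le> 1 / 144" .
    qed
    also have "\<dots> = (1 / 144) ^ Suc r" by simp
    finally show ?thesis .
  qed
  have finite: "finite (starts \<times> steps r (2 * r))"
    by (simp add: starts_def finite_steps)
  have card_starts: "real (card starts) \<le> 2 * (K / h) + 2"
  proof -
    have "K / h \<ge> 0" using K h by simp
    then show ?thesis unfolding starts_def by (simp; linarith)
  qed
  have "prob E \<le> (\<Sum>p\<in>starts \<times> steps r (2 * r). prob (A (path (fst p) (snd p))))"
    unfolding E_def split_def using finite A_event by (intro finite_measure_subadditive_finite) auto
  also have "\<dots> \<le> (\<Sum>p\<in>starts \<times> steps r (2 * r). (1 / 144) ^ Suc r)"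
    by (intro sum_mono A_prob)
  also have "\<dots> = real (card starts) * real (card (steps r (2 * r))) * (1 / 144) ^ Suc r"
    by (simp add: card_cartesian_product)
  \<comment> \<open>One of the \<open>r + 1\<close> hitting factors is given away.\<close>
  also have "\<dots> \<le> (2 * (K / h) + 2) * real (3 ^ (2 * r) * 2 ^ r) * (1 / 144) ^ r"
    using card_starts card_steps_le[of r "2 * r"] K h
    by (intro mult_mono of_nat_mono) (auto intro!: power_decreasing)
  also have "\<dots> = (2 * (K / h) + 2) * (1 / 8) ^ r"
    by (simp add: power_mult mult.assoc flip: power_mult_distrib)
  also have "\<dots> = (288 * K * L + 2) / 8 ^ r"
    using L by (simp add: h_def power_divide)
  finally have E_prob: "prob E \<le> (288 * K * L + 2) / 8 ^ r" .
  have "\<omega> \<in> E" if \<omega>: "\<omega> \<in> space M" and y: "\<And>i. i \<le> r \<Longrightarrow> y i \<in> Y (n i) \<omega>" "\<bar>y 0\<bar> \<le> K"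
    "(\<Sum>i<r. \<bar>y (Suc i) - y i\<bar>) \<le> real r / (144 * L)" for \<omega> and y :: "nat \<Rightarrow> real"
  proof -
    define g where "g i = \<lfloor>y i / h\<rfloor>" for i
    define ds where "ds = map (\<lambda>j. g (Suc j) - g j) [0..<r]"
    have path: "path (g 0) ds i = g i" if "i \<le> r" for i
    proof -
      have "(\<Sum>j<i. ds ! j) = (\<Sum>j<i. g (Suc j) - g j)"
        using that by (intro sum.cong) (auto simp: ds_def)
      then show ?thesis by (simp add: path_def sum_lessThan_telescope)
    qed
    have "y i \<in> cell (g i)" for i
    proof -
      have "real_of_int (g i) \<le> y i / h" "y i / h < real_of_int (g i) + 1"
        unfolding g_def by linarith+
      then show ?thesis using h by (simp add: cell_def field_simps)
    qed
    then have "\<omega> \<in> A (path (g 0) ds)"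
      using \<omega> y(1) path by (auto simp: A_def)
    moreover have "g 0 \<in> starts"
    proof -
      have "- (K / h) \<le> y 0 / h" "y 0 / h \<le> K / h"
        using y(2) h by (auto simp: field_simps abs_le_iff)
      then show ?thesis unfolding starts_def g_def by (simp add: floor_mono)
    qed
    moreover have "ds \<in> steps r (2 * r)"
    proof -
      have "real_of_int (\<Sum>d\<leftarrow>ds. \<bar>d\<bar>) = (\<Sum>j<r. real_of_int \<bar>g (Suc j) - g j\<bar>)"
        by (simp add: ds_def comp_def sum_list_distinct_conv_sum_set atLeast0LessThan flip: sum_list_of_int)
      \<comment> \<open>Rounding to cells enlarges each jump by at most 1. Hence variation
        \<open>r * h\<close> costs \<open>r\<close> cells for the motion and \<open>r\<close> for
        the rounding.\<close>
      also have "\<dots> \<le> (\<Sum>j<r. \<bar>y (Suc j) / h - y j / h\<bar> + 1)"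
        unfolding g_def by (intro sum_mono) linarith
      also have "\<dots> = (\<Sum>j<r. \<bar>y (Suc j) - y j\<bar>) / h + r"
        using h by (simp add: sum.distrib sum_divide_distrib flip: diff_divide_distrib)
      also have "\<dots> \<le> real r * h / h + r"
        using y(3) h by (intro add_right_mono divide_right_mono) (auto simp: h_def)
      also have "\<dots> = real_of_int (int (2 * r))" using h by simp
      finally have "(\<Sum>d\<leftarrow>ds. \<bar>d\<bar>) \<le> int (2 * r)" unfolding of_int_le_iff .
      then show ?thesis by (simp add: steps_def ds_def)
    qed
    ultimately show ?thesis by (auto simp: E_def)
  qed
  moreover have "E \<in> events"
    unfolding E_def using finite A_event by (intro sets.finite_UN) auto
  ultimately show ?thesis using E_prob that by blast
qed

end

subsection \<open>The almost sure statements\<close>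

text \<open>Intersect covers of probability at most \<open>1 / (j + 1)\<close>. The conclusion is a
  null superset because measurability of \<open>Z\<close> is not part of the hypotheses.\<close>

lemma (in prob_space) subset_null_set_if_small_covers:
  assumes "\<And>\<epsilon>. \<epsilon> > 0 \<Longrightarrow> \<exists>E\<in>events. prob E \<le> \<epsilon> \<and> Z \<subseteq> E"
  shows "\<exists>E\<in>null_sets M. Z \<subseteq> E"
proof -
  have "\<forall>j. \<exists>E. E \<in> events \<and> prob E \<le> 1 / real (Suc j) \<and> Z \<subseteq> E"
    using assms by (metis of_nat_0_less_iff zero_less_Suc zero_less_divide_1_iff)
  then obtain E where E: "\<And>j. E j \<in> events" "\<And>j. prob (E j) \<le> 1 / real (Suc j)" "\<And>j. Z \<subseteq> E j"
    by metis
  have event: "(\<Inter>j. E j) \<in> events" using E(1) by (intro sets.countable_INT) auto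
  have "prob (\<Inter>j. E j) \<le> 1 / real (Suc j)" for j
    by (rule order_trans[OF finite_measure_mono E(2)]) (auto simp: E(1))
  then have "prob (\<Inter>j. E j) \<le> 0"
    by (intro LIMSEQ_le_const[OF LIMSEQ_Suc[OF lim_1_over_n]]) auto
  with event have "(\<Inter>j. E j) \<in> null_sets M"
    by (intro null_setsI) (simp_all add: emeasure_eq_measure measure_le_0_iff)
  with E(3) show ?thesis by blast
qed

text \<open>The constant \<open>c\<close> absorbs the finitely many path steps lost when an initial
  segment of indices is discarded.\<close>

lemma eventually_linear_div_power_le:
  assumes "\<epsilon> > (0::real)"
  shows "\<forall>\<^sub>F N in sequentially. (a * real N + 2) / 8 ^ N * c \<le> \<epsilon>"
proof -
  have "(\<lambda>N. (a * (real N * (1 / 8) ^ N) + 2 * (1 / 8) ^ N) * c) \<longlonglongrightarrow> (a * 0 + 2 * 0) * c"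
    by (intro tendsto_intros powser_times_n_limit_0 LIMSEQ_power_zero) auto
  then have "(\<lambda>N. (a * real N + 2) / 8 ^ N * c) \<longlonglongrightarrow> 0"
    by (simp add: field_simps power_divide)
  from order_tendstoD(2)[OF this assms] show ?thesis
    by (rule eventually_mono) simp
qed

context poisson_processes
begin

text \<open>The common core of (ii) and (iii). Linear growth of the intensity bound is exactly what
  the method allows: cells of width of order \<open>1 / N\<close> crossed by about \<open>N\<close>
  steps give a variation threshold independent of \<open>N\<close>, while the probability decays
  exponentially in \<open>N\<close>.\<close>

lemma prob_BV_zero_if_many_small_rates:
  assumes C: "C > 0"
    and dense: "\<And>N0. \<exists>N\<ge>N0. \<exists>S. finite S \<and> S \<subseteq> {1..} \<and> card S \<ge> N \<and> (\<forall>n\<in>S. rate n \<le> C * real N)"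
  shows "prob (BV M Y) = 0"
proof -
  \<comment> \<open>Here \<open>576 = 4 * 144\<close>: the threshold
    \<open>r / (144 * (C * N))\<close> is at least \<open>1 / (576 * C)\<close> once
    \<open>N \<le> 4 * r\<close>.\<close>
  define Z where "Z m K = {\<omega> \<in> space M. \<exists>y. (\<forall>n\<ge>1. y n \<in> Y n \<omega>) \<and> (\<forall>n. \<bar>y n\<bar> \<le> real K) \<and>
    (\<forall>N. (\<Sum>j\<in>{m..<N}. \<bar>y (Suc j) - y j\<bar>) \<le> 1 / (576 * C))}" for m K :: nat
  have null: "\<exists>E\<in>null_sets M. Z m K \<subseteq> E" for m K
  proof (rule subset_null_set_if_small_covers)
    fix \<epsilon> :: real assume "\<epsilon> > 0"
    from eventually_linear_div_power_le[OF this, of "288 * real K * C" "8 ^ (m + 1)"]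
    obtain N0 where N0: "\<And>N. N \<ge> N0 \<Longrightarrow> (288 * real K * C * real N + 2) / 8 ^ N * 8 ^ (m + 1) \<le> \<epsilon>"
      unfolding eventually_sequentially by blast
    \<comment> \<open>With \<open>N \<ge> 2 * m + 2\<close>, at least half of \<open>N\<close>
      remains after \<open>m + 1\<close> is subtracted: \<open>m\<close> for the discarded indices
      and 1 because \<open>r + 1\<close> indices give \<open>r\<close> steps.\<close>
    obtain N S where N: "N \<ge> max N0 (2 * m + 2)"
      and S: "finite S" "S \<subseteq> {1..}" "card S \<ge> N" "\<forall>n\<in>S. rate n \<le> C * real N"
      using dense[of "max N0 (2 * m + 2)"] by blast
    \<comment> \<open>Visiting the indices in increasing order keeps the variation along them below
      that of the tail from \<open>m\<close>.\<close>
    define xs where "xs = sorted_list_of_set (S - {..<m})"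
    define r where "r = length xs - 1"
    have "card (S - {..<m}) \<ge> N - m"
      using diff_card_le_card_Diff[of "{..<m}" S] S(3) by simp
    then have length: "length xs \<ge> N - m" by (simp add: xs_def)
    then have xs: "length xs = Suc r" "r \<ge> N - m - 1" using N by (auto simp: r_def)
    have sorted: "sorted_wrt (<) xs" by (simp add: xs_def)
    have mem: "xs ! i \<in> S - {..<m}" if "i \<le> r" for i
      using nth_mem[of i xs] that xs(1) S(1) by (simp add: xs_def)
    have mono: "mono_on {..r} ((!) xs)"
      using sorted xs(1)
      by (intro mono_onI) (metis atMost_iff le_imp_less_Suc order_le_less sorted_wrt_nth_less)
    have inj: "inj_on ((!) xs) {..r}"
      using xs(1) by (intro inj_on_nth) (auto simp: xs_def)
    have L: "C * real N > 0" using C N by simp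
    obtain E where E: "E \<in> events" "prob E \<le> (288 * real K * (C * real N) + 2) / 8 ^ r"
      "\<And>\<omega> y. \<omega> \<in> space M \<Longrightarrow> (\<And>i. i \<le> r \<Longrightarrow> y i \<in> Y (xs ! i) \<omega>) \<Longrightarrow> \<bar>y 0\<bar> \<le> real K \<Longrightarrow>
        (\<Sum>i<r. \<bar>y (Suc i) - y i\<bar>) \<le> real r / (144 * (C * real N)) \<Longrightarrow> \<omega> \<in> E"
    proof (rule short_path_event[where K = "real K", OF inj _ _ L])
      show "xs ! i \<ge> 1" if "i \<le> r" for i using mem[OF that] S(2) by auto
      show "rate (xs ! i) \<le> C * real N" if "i \<le> r" for i using mem[OF that] S(4) by auto
    qed auto
    have "(288 * real K * (C * real N) + 2) / 8 ^ r \<le> (288 * real K * (C * real N) + 2) / 8 ^ (N - m - 1)"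
      using xs(2) C by (intro divide_left_mono power_increasing) auto
    also have "\<dots> = (288 * real K * C * real N + 2) / 8 ^ N * 8 ^ (m + 1)"
      using N power_add[of "8::real" "N - m - 1" "m + 1"] by (simp add: field_simps)
    also have "\<dots> \<le> \<epsilon>" using N0 N by simp
    finally have "prob E \<le> \<epsilon>" using E(2) by linarith
    moreover have "Z m K \<subseteq> E"
    proof
      fix \<omega> assume "\<omega> \<in> Z m K"
      then obtain y where \<omega>: "\<omega> \<in> space M" and y: "\<forall>n\<ge>1. y n \<in> Y n \<omega>" "\<forall>n. \<bar>y n\<bar> \<le> real K"
        "\<And>N. (\<Sum>j\<in>{m..<N}. \<bar>y (Suc j) - y j\<bar>) \<le> 1 / (576 * C)"
        unfolding Z_def by blast
      show "\<omega> \<in> E"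
      proof (rule E(3)[OF \<omega>, of "\<lambda>i. y (xs ! i)"])
        show "y (xs ! i) \<in> Y (xs ! i) \<omega>" if "i \<le> r" for i
          using y(1) mem[OF that] S(2) by auto
        show "\<bar>y (xs ! 0)\<bar> \<le> real K" using y(2) by blast
        have "(\<Sum>i<r. \<bar>y (xs ! Suc i) - y (xs ! i)\<bar>) \<le> (\<Sum>j\<in>{xs ! 0..<xs ! r}. \<bar>y (Suc j) - y j\<bar>)"
          using sum_variation_le[OF mono, of y] by simp
        also have "\<dots> \<le> (\<Sum>j\<in>{m..<xs ! r}. \<bar>y (Suc j) - y j\<bar>)"
          using mem[of 0] by (intro sum_mono2) auto
        also have "\<dots> \<le> 1 / (576 * C)" by (rule y(3))
        also have "\<dots> \<le> real r / (144 * (C * real N))"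
        proof -
          have "real N \<le> 4 * real r" using xs(2) N by linarith
          moreover have "real N > 0" using N by simp
          ultimately show ?thesis using C by (simp add: field_simps)
        qed
        finally show "(\<Sum>i<r. \<bar>y (xs ! Suc i) - y (xs ! i)\<bar>) \<le> real r / (144 * (C * real N))" .
      qed
    qed
    ultimately show "\<exists>E\<in>events. prob E \<le> \<epsilon> \<and> Z m K \<subseteq> E" using E(1) by blast
  qed
  have BV_subset: "BV M Y \<subseteq> (\<Union>m K. Z m K)"
  proof
    fix \<omega> assume "\<omega> \<in> BV M Y"
    then obtain y where \<omega>: "\<omega> \<in> space M" and y: "summable (\<lambda>n. \<bar>y (Suc n) - y n\<bar>)" "\<forall>n\<ge>1. y n \<in> Y n \<omega>"
      unfolding BV_iff_summable_variation by blast
    obtain K :: nat where "\<bar>y 0\<bar> + (\<Sum>n. \<bar>y (Suc n) - y n\<bar>) < K"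
      using reals_Archimedean2 by blast
    then have K: "\<bar>y n\<bar> \<le> real K" for n
      using summable_variation_bounded[OF y(1), of n] by linarith
    have "1 / (576 * C) > 0" using C by simp
    with y(1) obtain m where m: "\<forall>k\<ge>m. \<forall>N. norm (\<Sum>j\<in>{k..<N}. \<bar>y (Suc j) - y j\<bar>) < 1 / (576 * C)"
      unfolding summable_Cauchy by blast
    have "(\<Sum>j\<in>{m..<N}. \<bar>y (Suc j) - y j\<bar>) \<le> 1 / (576 * C)" for N
      using m[rule_format, of m N] by (simp add: sum_nonneg)
    with \<omega> y(2) K have "\<omega> \<in> Z m K" unfolding Z_def by blast
    then show "\<omega> \<in> (\<Union>m K. Z m K)" by blast
  qed
  have "\<forall>m K. \<exists>E. E \<in> null_sets M \<and> Z m K \<subseteq> E" using null by blast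
  then obtain E where E: "\<And>m K. E m K \<in> null_sets M" "\<And>m K. Z m K \<subseteq> E m K"
    by metis
  have "(\<Union>m K. Z m K) \<subseteq> (\<Union>m K. E m K)"
    by (intro UN_mono E(2)) auto
  with BV_subset have "BV M Y \<subseteq> (\<Union>m K. E m K)" by (rule order_trans)
  moreover have "(\<Union>m K. E m K) \<in> null_sets M"
    by (intro null_sets_UN E(1))
  ultimately have "BV M Y \<in> null_sets M"
    using null_sets_subset BV_event by blast
  then show ?thesis by (rule measure_eq_0_null_sets)
qed

text \<open>Monotonicity bounds all intensities of a dyadic block by the last one,
  \<open>L k\<close>, and is used again for condensation. Only the summability half of
  Borel-Cantelli is used, so the shared endpoints of neighbouring blocks do no harm.\<close>

lemma prob_BV_zero_if_mono:
  assumes mono: "mono_on {1..} rate"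
    and not_summable: "\<not> summable (\<lambda>n. 1 / rate (Suc n))"
  shows "prob (BV M Y) = 0"
proof -
  define L where "L k = rate (2 ^ Suc k)" for k
  have L: "L k > 0" for k unfolding L_def by (rule rate_pos) simp
  \<comment> \<open>The condition \<open>L k \<le> 4 ^ k\<close> guards only the covering property:
    an ignored block takes the empty event, so the probability bound holds for every
    \<open>k\<close>.\<close>
  define covers where "covers K k E \<longleftrightarrow> E \<in> events \<and> prob E \<le> (288 * real K * 4 ^ k + 2) / 8 ^ k \<and>
     (L k \<le> 4 ^ k \<longrightarrow> (\<forall>\<omega> y. \<omega> \<in> space M \<longrightarrow> (\<forall>n\<ge>1. y n \<in> Y n \<omega>) \<longrightarrow> (\<forall>n. \<bar>y n\<bar> \<le> real K) \<longrightarrow>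
       (\<Sum>j\<in>{2 ^ k..<2 ^ Suc k}. \<bar>y (Suc j) - y j\<bar>) \<le> 2 ^ k / (144 * L k) \<longrightarrow> \<omega> \<in> E))" for K k :: nat and E
  have "\<exists>E. covers K k E" for K k
  proof (cases "L k \<le> 4 ^ k")
    case True
    obtain E where E: "E \<in> events" "prob E \<le> (288 * real K * L k + 2) / 8 ^ (2 ^ k)"
      "\<And>\<omega> y. \<omega> \<in> space M \<Longrightarrow> (\<And>i. i \<le> 2 ^ k \<Longrightarrow> y i \<in> Y (2 ^ k + i) \<omega>) \<Longrightarrow> \<bar>y 0\<bar> \<le> real K \<Longrightarrow>
        (\<Sum>i<2 ^ k. \<bar>y (Suc i) - y i\<bar>) \<le> real (2 ^ k) / (144 * L k) \<Longrightarrow> \<omega> \<in> E"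
    proof (rule short_path_event[of "\<lambda>i. 2 ^ k + i" "2 ^ k" "L k" "real K"])
      show "2 ^ k + i \<ge> 1" for i :: nat by (simp add: Suc_le_eq)
      show "rate (2 ^ k + i) \<le> L k" if "i \<le> 2 ^ k" for i
        unfolding L_def using that by (intro mono_onD[OF mono]) (auto simp: Suc_le_eq)
    qed (auto simp: L)
    \<comment> \<open>A block has \<open>2 ^ k\<close> steps; the decay \<open>8 ^ -(2 ^ k)\<close>
      is weakened to \<open>8 ^ -k\<close>, which still makes \<open>4 ^ k / 8 ^ k\<close>
      summable.\<close>
    have "prob E \<le> (288 * real K * 4 ^ k + 2) / 8 ^ k"
      using True by (intro order_trans[OF E(2)] frac_le power_increasing add_mono mult_left_mono)
        (auto simp: less_imp_le[OF less_exp])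
    moreover have "\<omega> \<in> E" if "\<omega> \<in> space M" "\<forall>n\<ge>1. y n \<in> Y n \<omega>" "\<forall>n. \<bar>y n\<bar> \<le> real K"
      "(\<Sum>j\<in>{2 ^ k..<2 ^ Suc k}. \<bar>y (Suc j) - y j\<bar>) \<le> 2 ^ k / (144 * L k)" for \<omega> and y :: "nat \<Rightarrow> real"
    proof (rule E(3)[OF that(1), of "\<lambda>i. y (2 ^ k + i)"])
      show "y (2 ^ k + i) \<in> Y (2 ^ k + i) \<omega>" for i
        using that(2) by (simp add: Suc_le_eq)
      have "(\<Sum>i<2 ^ k. \<bar>y (2 ^ k + Suc i) - y (2 ^ k + i)\<bar>) = (\<Sum>j\<in>{2 ^ k..<2 ^ Suc k}. \<bar>y (Suc j) - y j\<bar>)"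
        using sum.shift_bounds_nat_ivl[of "\<lambda>j. \<bar>y (Suc j) - y j\<bar>" 0 "2 ^ k" "2 ^ k"]
        by (simp add: atLeast0LessThan add.commute mult_2)
      then show "(\<Sum>i<2 ^ k. \<bar>y (2 ^ k + Suc i) - y (2 ^ k + i)\<bar>) \<le> real (2 ^ k) / (144 * L k)"
        using that(4) by simp
    qed (use that(3) in auto)
    ultimately show ?thesis using E(1) unfolding covers_def by blast
  qed (auto simp: covers_def intro!: exI[of _ "{}"])
  then obtain E where covers: "\<And>K k. covers K k (E K k)" by metis
  have E: "E K k \<in> events" "prob (E K k) \<le> (288 * real K * 4 ^ k + 2) / 8 ^ k" for K k
    using covers[of K k] by (simp_all add: covers_def)
  have "AE \<omega> in M. \<forall>\<^sub>F k in sequentially. \<omega> \<in> space M - E K k" for K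
  proof (rule borel_cantelli_AE1[OF E(1)])
    have "summable (\<lambda>k. 288 * real K * (4 / 8) ^ k + 2 * (1 / 8) ^ k)"
      by (intro summable_add summable_mult summable_geometric) auto
    also have "(\<lambda>k. 288 * real K * (4 / 8) ^ k + 2 * (1 / 8) ^ k) = (\<lambda>k. (288 * real K * 4 ^ k + 2) / 8 ^ k)"
      by (simp only: power_divide add_divide_distrib power_one) simp
    finally show "summable (\<lambda>k. prob (E K k))"
      by (rule summable_comparison_test'[where N = 0]) (use E(2) in auto)
  qed (simp add: emeasure_eq_measure)
  then have "AE \<omega> in M. \<forall>K. \<forall>\<^sub>F k in sequentially. \<omega> \<in> space M - E K k"
    by (simp add: AE_all_countable)
  then have "AE \<omega> in M. \<omega> \<notin> BV M Y"
  proof (rule AE_mp, intro AE_I2 impI notI)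
    fix \<omega> assume ev: "\<forall>K. \<forall>\<^sub>F k in sequentially. \<omega> \<in> space M - E K k" and "\<omega> \<in> BV M Y"
    then obtain y where \<omega>: "\<omega> \<in> space M" and y: "summable (\<lambda>n. \<bar>y (Suc n) - y n\<bar>)" "\<forall>n\<ge>1. y n \<in> Y n \<omega>"
      unfolding BV_iff_summable_variation by blast
    obtain K :: nat where "\<bar>y 0\<bar> + (\<Sum>n. \<bar>y (Suc n) - y n\<bar>) < K"
      using reals_Archimedean2 by blast
    then have K: "\<forall>n. \<bar>y n\<bar> \<le> real K"
      using summable_variation_bounded[OF y(1)] by (auto intro: order_trans less_imp_le)
    \<comment> \<open>Consecutive blocks share an index but no increment, so the \<open>D k\<close>
      add up to the variation from index 1 on.\<close>
    define D where "D k = (\<Sum>j\<in>{2 ^ k..<2 ^ Suc k}. \<bar>y (Suc j) - y j\<bar>)" for k :: nat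
    have D_nonneg: "D k \<ge> 0" for k unfolding D_def by (simp add: sum_nonneg)
    have "summable D"
    proof (rule summableI_nonneg_bounded[OF D_nonneg])
      fix n
      have "(\<Sum>k<n. D k) = (\<Sum>j\<in>{1..<2 ^ n}. \<bar>y (Suc j) - y j\<bar>)"
      proof (induction n)
        case (Suc n)
        then show ?case
          using sum.atLeastLessThan_concat[of 1 "2 ^ n" "2 ^ Suc n" "\<lambda>j. \<bar>y (Suc j) - y j\<bar>"]
          by (simp add: D_def)
      qed simp
      also have "\<dots> \<le> (\<Sum>n. \<bar>y (Suc n) - y n\<bar>)"
        by (rule sum_le_suminf[OF y(1)]) auto
      finally show "(\<Sum>k<n. D k) \<le> (\<Sum>n. \<bar>y (Suc n) - y n\<bar>)" .
    qed
    then have "summable (\<lambda>k. 144 * D k + (1 / 2) ^ k)"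
      by (intro summable_add summable_mult summable_geometric) auto
    \<comment> \<open>The first summand handles blocks with \<open>L k \<le> 4 ^ k\<close>, where
      avoiding \<open>E K k\<close> forces large variation; the second handles the ignored
      blocks.\<close>
    moreover have "\<forall>\<^sub>F k in sequentially. norm (2 ^ k / L k) \<le> 144 * D k + (1 / 2) ^ k"
      using ev[rule_format, of K]
    proof (rule eventually_mono)
      fix k assume k: "\<omega> \<in> space M - E K k"
      show "norm (2 ^ k / L k) \<le> 144 * D k + (1 / 2) ^ k"
      proof (cases "L k \<le> 4 ^ k")
        case True
        with covers[of K k] k \<omega> y(2) K have "2 ^ k / (144 * L k) < D k"
          unfolding covers_def D_def by (meson DiffD2 not_le)
        then have "2 ^ k / L k \<le> 144 * D k" by simp
        then show ?thesis using L[of k] by (simp add: add_increasing2)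
      next
        case False
        then have "2 ^ k / L k \<le> 2 ^ k / 4 ^ k" using L[of k] by (intro divide_left_mono) auto
        also have "\<dots> = (1 / 2) ^ k" by (simp flip: power_divide)
        finally show ?thesis using L[of k] D_nonneg[of k] by simp
      qed
    qed
    ultimately have "summable (\<lambda>k. 2 ^ k / L k)"
      by (rule summable_comparison_test_ev[rotated])
    then have "summable (\<lambda>k. 2 * (2 ^ k / L k))" by (rule summable_mult)
    \<comment> \<open>Since \<open>L k\<close> sits at \<open>2 ^ (k + 1)\<close>, doubling gives
      the condensed series shifted by one. The default 0 replaces the unconstrained value
      \<open>rate 0\<close>.\<close>
    then have "summable (\<lambda>k. 2 ^ Suc k * (if 2 ^ Suc k = (0::nat) then 0 else 1 / rate (2 ^ Suc k)))"
      by (simp add: L_def)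
    then have "summable (\<lambda>k. 2 ^ k * (if 2 ^ k = (0::nat) then 0 else 1 / rate (2 ^ k)))"
      by (subst (asm) summable_Suc_iff)
    moreover have "1 / rate (Suc m) \<le> 1 / rate m" if "m > 0" for m
      using that rate_pos[of m] by (intro divide_left_mono mono_onD[OF mono]) (auto simp: rate_pos)
    ultimately have "summable (\<lambda>n. if n = 0 then 0 else 1 / rate n)"
      by (subst condensation_test) (auto simp: Suc_le_eq less_imp_le[OF rate_pos])
    then show False
      using not_summable summable_Suc_iff[of "\<lambda>n. if n = 0 then 0 else 1 / rate n"] by simp
  qed
  then show ?thesis
    using BV_event AE_iff_null_sets measure_eq_0_null_sets by blast
qed

end

section \<open>Reduction of the three conditions to the two criteria\<close>

theorem theorem7:
  fixes M :: "'w measure"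
    and rate :: "nat \<Rightarrow> real"
    and Y :: "nat \<Rightarrow> 'w \<Rightarrow> real set"
  assumes "prob_space M"
    and "complete_measure M"
    and "\<And>n. n \<ge> 1 \<Longrightarrow> rate n > 0"
    and "\<And>n. n \<ge> 1 \<Longrightarrow> homogeneous_poisson_process M (Y n) (rate n)"
    and "prob_space.indep_vars M (\<lambda>_. config_algebra) Y {1..}"
  shows "BV M Y \<in> sets M \<and>
    ((mono_on {1..} rate \<and> (\<Sum>n. ennreal (1 / rate (Suc n))) = \<infinity>) \<or>
     liminf (\<lambda>n. ereal (rate n)) < \<infinity> \<or>
     (filterlim rate at_top sequentially \<and>
      (\<exists>\<mu>. increasing_rearrangement rate \<mu> \<and>
           limsup (\<lambda>n. ereal (real n / \<mu> n)) > 0))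
     \<longrightarrow> measure M (BV M Y) = 0)"
proof -
  interpret prob_space M by fact
  interpret poisson_processes M rate Y
    by unfold_locales (use assms in auto)
  have "measure M (BV M Y) = 0"
    if "mono_on {1..} rate" and infinite: "(\<Sum>n. ennreal (1 / rate (Suc n))) = \<infinity>"
  proof (rule prob_BV_zero_if_mono[OF that(1)], rule notI)
    assume "summable (\<lambda>n. 1 / rate (Suc n))"
    then have "(\<Sum>n. ennreal (1 / rate (Suc n))) = ennreal (\<Sum>n. 1 / rate (Suc n))"
      by (intro suminf_ennreal2) (auto simp: less_imp_le[OF rate_pos])
    with infinite show False by simp
  qed
  moreover have "measure M (BV M Y) = 0" if "liminf (\<lambda>n. ereal (rate n)) < \<infinity>"
  proof -
    from that have "liminf (\<lambda>n. ereal (rate n)) \<noteq> \<infinity>" by simp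
    then obtain C where C: "liminf (\<lambda>n. ereal (rate n)) < ereal C"
      unfolding less_PInf_Ex_of_nat by blast
    \<comment> \<open>The maximum with 1 makes positivity of the constant for the criterion
      immediate.\<close>
    have "\<not> (\<forall>\<^sub>F n in sequentially. rate n \<ge> max C 1)"
    proof
      assume "\<forall>\<^sub>F n in sequentially. rate n \<ge> max C 1"
      then have "\<forall>\<^sub>F n in sequentially. ereal C \<le> ereal (rate n)"
        by (rule eventually_mono) simp
      then have "ereal C \<le> liminf (\<lambda>n. ereal (rate n))" by (rule Liminf_bounded)
      with C show False by simp
    qed
    then have frequently: "\<exists>n\<ge>m. rate n < max C 1" for m
      unfolding eventually_sequentially by (meson not_le)
    have infinite: "infinite {n. n \<ge> 1 \<and> rate n < max C 1}"
      unfolding infinite_nat_iff_unbounded_le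
      by (metis (mono_tags, lifting) frequently max.bounded_iff mem_Collect_eq)
    show ?thesis
    proof (rule prob_BV_zero_if_many_small_rates[of "max C 1"])
      fix N0 :: nat
      obtain S where S: "finite S" "card S = Suc N0" "S \<subseteq> {n. n \<ge> 1 \<and> rate n < max C 1}"
        using infinite_arbitrarily_large[OF infinite] by blast
      \<comment> \<open>A constant bound is in particular linear in \<open>N\<close>; the choice
        \<open>N = Suc N0\<close> ensures \<open>N \<ge> 1\<close>.\<close>
      have "max C 1 * 1 \<le> max C 1 * real (Suc N0)" by (intro mult_left_mono) auto
      with S show "\<exists>N\<ge>N0. \<exists>S. finite S \<and> S \<subseteq> {1..} \<and> card S \<ge> N \<and> (\<forall>n\<in>S. rate n \<le> max C 1 * real N)"
        by (intro exI[of _ "Suc N0"] conjI exI[of _ S]) fastforce+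
    qed simp
  qed
  moreover have "measure M (BV M Y) = 0"
    if \<mu>: "increasing_rearrangement rate \<mu>" "limsup (\<lambda>n. ereal (real n / \<mu> n)) > 0" for \<mu>
  proof -
    obtain \<sigma> where \<sigma>: "bij_betw \<sigma> {1..} {1..}" "\<And>n. n \<ge> 1 \<Longrightarrow> \<mu> n = rate (\<sigma> n)" and mono: "mono_on {1..} \<mu>"
      using \<mu>(1) unfolding increasing_rearrangement_def by blast
    have \<sigma>_ge: "\<sigma> n \<ge> 1" if "n \<ge> 1" for n
      using bij_betwE[OF \<sigma>(1)] that by auto
    \<comment> \<open>For infinitely many \<open>N\<close> then \<open>\<mu> N < N / c\<close>, and
      the \<open>N\<close> smallest intensities are at most \<open>\<mu> N\<close>; this gives the
      criterion with constant \<open>1 / c\<close>.\<close>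
    obtain c where c: "0 < ereal c" "ereal c < limsup (\<lambda>n. ereal (real n / \<mu> n))"
      using ereal_dense2[OF \<mu>(2)] by blast
    have "\<not> (\<forall>\<^sub>F n in sequentially. real n / \<mu> n \<le> c)"
    proof
      assume "\<forall>\<^sub>F n in sequentially. real n / \<mu> n \<le> c"
      then have "limsup (\<lambda>n. ereal (real n / \<mu> n)) \<le> ereal c"
        by (intro Limsup_bounded) simp
      with c(2) show False by simp
    qed
    then have frequently: "\<exists>n\<ge>m. real n / \<mu> n > c" for m
      by (auto simp: eventually_sequentially not_le)
    show ?thesis
    proof (rule prob_BV_zero_if_many_small_rates[of "1 / c"])
      fix N0 :: nat
      \<comment> \<open>The bound \<open>N \<ge> 1\<close> avoids the arbitrary value
        \<open>\<mu> 0\<close>.\<close>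
      obtain N where N: "N \<ge> max 1 N0" "real N / \<mu> N > c" using frequently by blast
      have "\<mu> N > 0" using N(1) \<sigma>_ge[of N] rate_pos[of "\<sigma> N"] by (simp add: \<sigma>(2))
      with N(2) c(1) have bound: "\<mu> N \<le> 1 / c * real N" by (simp add: field_simps)
      have "card (\<sigma> ` {1..N}) = N"
        using \<sigma>(1) by (subst card_image) (auto simp: bij_betw_def intro: inj_on_subset)
      moreover have "rate n \<le> 1 / c * real N" if "n \<in> \<sigma> ` {1..N}" for n
      proof -
        obtain i where i: "n = \<sigma> i" "i \<in> {1..N}" using \<open>n \<in> \<sigma> ` {1..N}\<close> by blast
        then have "rate n = \<mu> i" by (simp add: \<sigma>(2))
        also have "\<dots> \<le> \<mu> N" using i(2) by (intro mono_onD[OF mono]) auto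
        finally show ?thesis using bound by linarith
      qed
      moreover have "\<sigma> ` {1..N} \<subseteq> {1..}" using \<sigma>_ge by auto
      ultimately show "\<exists>N\<ge>N0. \<exists>S. finite S \<and> S \<subseteq> {1..} \<and> card S \<ge> N \<and> (\<forall>n\<in>S. rate n \<le> 1 / c * real N)"
        using N(1) by (intro exI[of _ N] conjI exI[of _ "\<sigma> ` {1..N}"]) auto
    qed (use c(1) in simp)
  qed
  ultimately show ?thesis using BV_event by blast
qed

end
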